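(* For any graph $G$ with $|V(G)|\geq 3$, we have $\mathrm{scw}(G)\leq \mathrm{vcon}(G)$.
   Context: A graph is a finite, connected, loopless multigraph. Screewidth: a tree-cut decomposition of $G$ is a pair $\mathcal{T}=(T,\mathcal{X})$ where $T$ is a tree (its vertices are called nodes, its edges links) and $\mathcal{X}=(X_b)_{b\in V(T)}$ is a family of (possibly empty) subsets of $V(G)$ such that each vertex of $G$ lies in exactly one $X_b$. The adhesion $\mathrm{adh}(l)$ of a link $l$ is the set of edges of $G$ whose endpoints lie in bags belonging to different components of $T-l$. The adhesion $\mathrm{adh}(b)$ of a non-leaf node $b$ is the set of edges of $G$ whose endpoints lie in bags belonging to different components of $T-b$; for a leaf node $b$, $\mathrm{adh}(b)=\emptyset$. The width of $\mathcal{T}$ is $$w(\mathcal{T})=\max\Bigl(\max_{l\in E(T)}|\mathrm{adh}(l)|,\ \max_{b\in V(T)}\bigl(|X_b|+|\mathrm{adh}(b)|\bigr)\Bigr),$$ and the screewidth is $\mathrm{scw}(G)=\min_{\mathcal{T}}w(\mathcal{T})$ over all tree-cut decompositions of $G$. Vertex congestion: an embedding of $G$ is an injection $\pi$ from $V(G)$ to the leaves of a sub-cubic tree $T$ (a tree of maximum degree at most $3$). For an edge $vw\in E(G)$ let $P_{vw}$ be the path in $T$ from $\pi(v)$ to $\pi(w)$. The vertex congestion of $\pi$ is $\max_{u\in V(T)}|\{vw\in E(G) : u\in P_{vw}\}|$ (parallel edges counted with multiplicity). $\mathrm{vcon}(G)$ is the minimum vertex congestion over all embeddings $\pi$ of $G$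 (over all sub-cubic trees $T$). *)

theory Defs
  imports Main
begin

record ('v, 'e) mgraph =
  verts :: "'v set"
  edges :: "'e set"
  ends  :: "'e \<Rightarrow> 'v set"

definition adj :: "('v, 'e) mgraph \<Rightarrow> 'v \<Rightarrow> 'v \<Rightarrow> bool" where
  "adj G u v \<longleftrightarrow> (\<exists>e\<in>edges G. ends G e = {u, v})"

definition components :: "('v, 'e) mgraph \<Rightarrow> 'v set set" where
  "components G = {{v \<in> verts G. (adj G)\<^sup>*\<^sup>* u v} | u. u \<in> verts G}"

definition connected :: "('v, 'e) mgraph \<Rightarrow> bool" where
  "connected G \<longleftrightarrow> verts G \<noteq> {} \<and> (\<forall>u\<in>verts G. \<forall>v\<in>verts G. (adj G)\<^sup>*\<^sup>* u v)"

text \<open>Parallel edges are distinct elements of \<open>edges G\<close> with the same set of ends;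
  the requirement that every edge has exactly two ends excludes loops.\<close>

definition graph :: "('v, 'e) mgraph \<Rightarrow> bool" where
  "graph G \<longleftrightarrow> finite (verts G) \<and> finite (edges G) \<and>
     (\<forall>e\<in>edges G. ends G e \<subseteq> verts G \<and> card (ends G e) = 2) \<and> connected G"

definition degree :: "('v, 'e) mgraph \<Rightarrow> 'v \<Rightarrow> nat" where
  "degree G v = card {e \<in> edges G. v \<in> ends G e}"

definition leaf :: "('v, 'e) mgraph \<Rightarrow> 'v \<Rightarrow> bool" where
  "leaf G v \<longleftrightarrow> v \<in> verts G \<and> degree G v = 1"

definition del_edge :: "('v, 'e) mgraph \<Rightarrow> 'e \<Rightarrow> ('v, 'e) mgraph" where
  "del_edge G l = \<lparr>verts = verts G, edges = edges G - {l}, ends = ends G\<rparr>"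

definition del_vert :: "('v, 'e) mgraph \<Rightarrow> 'v \<Rightarrow> ('v, 'e) mgraph" where
  "del_vert G b =
     \<lparr>verts = verts G - {b}, edges = {e \<in> edges G. b \<notin> ends G e}, ends = ends G\<rparr>"

text \<open>A cycle is a cyclic sequence of distinct vertices and distinct edges; two parallel
  edges form a cycle of length 2.\<close>

definition is_cycle :: "('v, 'e) mgraph \<Rightarrow> 'v list \<Rightarrow> 'e list \<Rightarrow> bool" where
  "is_cycle G vs es \<longleftrightarrow>
     length vs \<ge> 2 \<and> length es = length vs \<and> distinct vs \<and> distinct es \<and>
     set vs \<subseteq> verts G \<and> set es \<subseteq> edges G \<and>
     (\<forall>i<length vs. ends G (es ! i) = {vs ! i, vs ! (Suc i mod length vs)})"

definition tree :: "('v, 'e) mgraph \<Rightarrow> bool" where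
  "tree T \<longleftrightarrow> graph T \<and> (\<nexists>vs es. is_cycle T vs es)"

definition subcubic :: "('v, 'e) mgraph \<Rightarrow> bool" where
  "subcubic T \<longleftrightarrow> (\<forall>v\<in>verts T. degree T v \<le> 3)"

text \<open>Paths are given by their vertex sequences, which determine them in graphs without
  parallel edges, in particular in trees.\<close>

definition is_path :: "('v, 'e) mgraph \<Rightarrow> 'v \<Rightarrow> 'v list \<Rightarrow> 'v \<Rightarrow> bool" where
  "is_path G x p y \<longleftrightarrow>
     p \<noteq> [] \<and> hd p = x \<and> last p = y \<and> distinct p \<and> set p \<subseteq> verts G \<and> successively (adj G) p"

definition tree_path :: "('v, 'e) mgraph \<Rightarrow> 'v \<Rightarrow> 'v \<Rightarrow> 'v list" where
  "tree_path T x y = (THE p. is_path T x p y)"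


definition tree_cut_decomposition ::
    "('v, 'e) mgraph \<Rightarrow> ('n, 'l) mgraph \<Rightarrow> ('n \<Rightarrow> 'v set) \<Rightarrow> bool" where
  "tree_cut_decomposition G T X \<longleftrightarrow>
     tree T \<and> (\<forall>b\<in>verts T. X b \<subseteq> verts G) \<and> (\<forall>v\<in>verts G. \<exists>!b. b \<in> verts T \<and> v \<in> X b)"

text \<open>The edges of \<open>G\<close> whose ends lie in bags of different components of a subforest \<open>F\<close>
  of the decomposition tree.\<close>

definition crossing_edges ::
    "('v, 'e) mgraph \<Rightarrow> ('n, 'l) mgraph \<Rightarrow> ('n \<Rightarrow> 'v set) \<Rightarrow> 'e set" where
  "crossing_edges G F X =
     {e \<in> edges G. \<exists>v w. ends G e = {v, w} \<and>
        (\<exists>C\<in>components F. \<exists>D\<in>components F. C \<noteq> D \<and> (\<exists>c\<in>C. v \<in> X c) \<and> (\<exists>d\<in>D. w \<in> X d))}"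

definition link_adhesion ::
    "('v, 'e) mgraph \<Rightarrow> ('n, 'l) mgraph \<Rightarrow> ('n \<Rightarrow> 'v set) \<Rightarrow> 'l \<Rightarrow> 'e set" where
  "link_adhesion G T X l = crossing_edges G (del_edge T l) X"

definition node_adhesion ::
    "('v, 'e) mgraph \<Rightarrow> ('n, 'l) mgraph \<Rightarrow> ('n \<Rightarrow> 'v set) \<Rightarrow> 'n \<Rightarrow> 'e set" where
  "node_adhesion G T X b = (if leaf T b then {} else crossing_edges G (del_vert T b) X)"

text \<open>One maximum over both families of numbers, so that a tree without links needs no
  convention for the empty maximum.\<close>

definition width :: "('v, 'e) mgraph \<Rightarrow> ('n, 'l) mgraph \<Rightarrow> ('n \<Rightarrow> 'v set) \<Rightarrow> nat" where
  "width G T X =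
     Max ((\<lambda>l. card (link_adhesion G T X l)) ` edges T \<union>
          (\<lambda>b. card (X b) + card (node_adhesion G T X b)) ` verts T)"

text \<open>Trees are finite, so up to isomorphism their nodes and links may be taken to be
  natural numbers. Every graph has a tree-cut decomposition (with a single node) and an
  embedding (into a caterpillar), so both minima below exist.\<close>

definition scw :: "('v, 'e) mgraph \<Rightarrow> nat" where
  "scw G = (LEAST k. \<exists>(T :: (nat, nat) mgraph) X. tree_cut_decomposition G T X \<and> width G T X = k)"


definition embedding ::
    "('v, 'e) mgraph \<Rightarrow> ('n, 'l) mgraph \<Rightarrow> ('v \<Rightarrow> 'n) \<Rightarrow> bool" where
  "embedding G T \<pi> \<longleftrightarrow>
     tree T \<and> subcubic T \<and> inj_on \<pi> (verts G) \<and> (\<forall>v\<in>verts G. leaf T (\<pi> v))"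

definition vertex_congestion ::
    "('v, 'e) mgraph \<Rightarrow> ('n, 'l) mgraph \<Rightarrow> ('v \<Rightarrow> 'n) \<Rightarrow> nat" where
  "vertex_congestion G T \<pi> =
     Max ((\<lambda>u. card {e \<in> edges G. \<exists>v w. ends G e = {v, w} \<and> u \<in> set (tree_path T (\<pi> v) (\<pi> w))})
          ` verts T)"

definition vcon :: "('v, 'e) mgraph \<Rightarrow> nat" where
  "vcon G = (LEAST k. \<exists>(T :: (nat, nat) mgraph) \<pi>. embedding G T \<pi> \<and> vertex_congestion G T \<pi> = k)"

end

theory Submission
  imports Defs
begin

text \<open>In an optimal embedding let the bag of a tree node consist of the vertex embedded at it,
  if any. An edge of the adhesion of a node \<open>b\<close> has its ends embedded in different components
  of \<open>T - b\<close>, so its tree path runs through \<open>b\<close>; an edge of the adhesion of a link has a tree path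
  through both ends of that link. Only leaves have nonempty bags, and their adhesion is empty, so
  they contribute at most 1, which is at most the congestion because the graph has an edge.\<close>

section \<open>Paths in trees\<close>

lemma adj_sym: "adj G u v \<Longrightarrow> adj G v u"
  by (auto simp: adj_def insert_commute)

lemma adj_rtranclp_sym: "(adj G)\<^sup>*\<^sup>* u v \<Longrightarrow> (adj G)\<^sup>*\<^sup>* v u"
  by (metis adj_sym sympD sympI symp_rtranclp)

lemma successively_rtranclp:
  "successively R p \<Longrightarrow> p \<noteq> [] \<Longrightarrow> R\<^sup>*\<^sup>* (hd p) (last p)"
proof (induction p rule: induct_list012)
  case (3 x y zs)
  then show ?case by (auto intro: converse_rtranclp_into_rtranclp)
qed auto

lemma graph_adj_verts:
  assumes "graph G" "adj G u v"
  shows "u \<in> verts G" "v \<in> verts G" "u \<noteq> v"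
  using assms by (auto simp: graph_def adj_def)

text \<open>A walk is turned into a path from its far end backwards: if the new first vertex already
  lies on the path found so far, everything before that occurrence is dropped.\<close>

lemma is_path_exists:
  assumes "graph G" "(adj G)\<^sup>*\<^sup>* x y" "y \<in> verts G"
  shows "\<exists>p. is_path G x p y"
  using assms(2)
proof (induction rule: converse_rtranclp_induct)
  case base
  then show ?case using assms(3) by (intro exI[of _ "[y]"]) (auto simp: is_path_def)
next
  case (step x z)
  then obtain p where p: "is_path G z p y" by blast
  show ?case
  proof (cases "x \<in> set p")
    case True
    then obtain a b where "p = a @ x # b" by (auto simp: in_set_conv_decomp)
    then have "is_path G x (x # b) y" using p
      by (auto simp: is_path_def successively_append_iff)
    then show ?thesis by blast
  next
    case False
    then have "is_path G x (x # p) y"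
      using p step(1) graph_adj_verts[OF assms(1) step(1)]
      by (cases p) (auto simp: is_path_def)
    then show ?thesis by blast
  qed
qed

text \<open>Adjacency only promises some edge for each consecutive pair, while
  \<open>is_cycle\<close> wants distinct edges. With at least three vertices, different positions
  have different end sets, so any choice of edges is injective.\<close>

lemma closed_path_is_cycle:
  assumes "length vs \<ge> 3" "distinct vs" "set vs \<subseteq> verts G"
    and "successively (adj G) vs" "adj G (last vs) (hd vs)"
  shows "\<exists>es. is_cycle G vs es"
proof -
  let ?n = "length vs"
  have "adj G (vs ! i) (vs ! (Suc i mod ?n))" if "i < ?n" for i
  proof (cases "Suc i < ?n")
    case True
    then show ?thesis using assms(4) by (auto simp: successively_conv_nth)
  next
    case False
    then have "Suc i = ?n" using that by simp
    then have "i = ?n - 1" "Suc i mod ?n = 0" by auto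
    then show ?thesis using assms(1,5) by (metis last_conv_nth hd_conv_nth list.size(3) not_numeral_le_zero)
  qed
  then obtain f where f: "\<And>i. i < ?n \<Longrightarrow> f i \<in> edges G \<and> ends G (f i) = {vs ! i, vs ! (Suc i mod ?n)}"
    unfolding adj_def by metis
  have "inj_on f {..<?n}"
  proof (rule inj_onI)
    fix i j assume ij: "i \<in> {..<?n}" "j \<in> {..<?n}" "f i = f j"
    have lt: "Suc i mod ?n < ?n" "Suc j mod ?n < ?n" using ij by (auto intro: mod_less_divisor)
    have "{vs ! i, vs ! (Suc i mod ?n)} = {vs ! j, vs ! (Suc j mod ?n)}" using f ij by (metis lessThan_iff)
    then have "i = j \<or> (i = Suc j mod ?n \<and> j = Suc i mod ?n)"
      using assms(2) ij lt by (auto simp: doubleton_eq_iff nth_eq_iff_index_eq)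
    \<comment> \<open>Two positions that are cyclic successors of each other would force
      \<open>?n\<close> to divide 2.\<close>
    then show "i = j" using assms(1) ij
      by (auto simp: mod_Suc split: if_splits)
  qed
  then have "is_cycle G vs (map f [0..<?n])"
    using assms f by (auto simp: is_cycle_def distinct_map lessThan_atLeast0)
  then show ?thesis by blast
qed

text \<open>Common first vertices are stripped by induction. Where the two paths diverge, following
  one until it first meets the other and returning along the other closes a cycle.\<close>

lemma is_path_unique:
  assumes "tree T" "is_path T x p y" "is_path T x q y"
  shows "p = q"
  using assms(2,3)
proof (induction p arbitrary: x q)
  case Nil
  then show ?case by (simp add: is_path_def)
next
  case (Cons a p)
  then have [simp]: "a = x" by (simp add: is_path_def)
  obtain q' where q: "q = x # q'" using Cons.prems(2) by (cases q) (auto simp: is_path_def)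
  show ?case
  proof (cases "x = y")
    case True
    then have "p = []" "q' = []" using Cons.prems q
      by (auto simp: is_path_def split: if_splits)
    then show ?thesis using q by simp
  next
    case False
    then have ne: "p \<noteq> []" "q' \<noteq> []" using Cons.prems q by (auto simp: is_path_def)
    have sub: "is_path T (hd p) p y" "is_path T (hd q') q' y"
      using Cons.prems q ne by (auto simp: is_path_def successively_Cons)
    show ?thesis
    proof (cases "hd p = hd q'")
      case True
      then show ?thesis using Cons.IH[OF sub(1)] sub(2) q by simp
    next
      case False
      have "y \<in> set p" "y \<in> set q'" using sub unfolding is_path_def by (metis last_in_set)+
      then have "\<exists>z\<in>set p. z \<in> set q'" by blast
      from split_list_first_prop[OF this]
      obtain p1 z p2 where p1: "p = p1 @ z # p2" "z \<in> set q'" "\<forall>u\<in>set p1. u \<notin> set q'"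
        by blast
      obtain q1 q2 where q1: "q' = q1 @ z # q2" using p1(2) by (auto simp: in_set_conv_decomp)
      let ?vs = "x # p1 @ z # rev q1"
      \<comment> \<open>If both were empty, \<open>z\<close> would be the second vertex of both
        paths. So the cycle has a vertex besides \<open>x\<close> and \<open>z\<close>.\<close>
      have "p1 \<noteq> [] \<or> q1 \<noteq> []" using False p1 q1 by auto
      then have len: "length ?vs \<ge> 3" by (cases p1; cases q1) auto
      have dist: "distinct ?vs" "set ?vs \<subseteq> verts T"
        using Cons.prems q p1 q1 by (auto simp: is_path_def)
      have sp: "successively (adj T) (x # p1 @ [z])" "successively (adj T) (x # q1 @ [z])"
        using Cons.prems q p1(1) q1
        by (auto simp: is_path_def successively_append_iff successively_Cons hd_append split: if_splits)
      have "(\<lambda>u v. adj T v u) = adj T" by (intro ext) (metis adj_sym)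
      then have "successively (adj T) (rev (x # q1 @ [z]))"
        using sp(2) by (simp only: successively_rev)
      then have rs: "successively (adj T) (z # rev q1 @ [x])" by simp
      have "successively (adj T) (z # rev q1)" "adj T (last (z # rev q1)) x"
        using rs by (auto simp: successively_append_iff successively_Cons hd_append last_rev split: if_splits)
      moreover have "successively (adj T) ?vs"
        using sp(1) calculation(1)
        by (auto simp: successively_append_iff successively_Cons hd_append split: if_splits)
      ultimately have "\<exists>es. is_cycle T ?vs es"
        using closed_path_is_cycle[OF len dist] by simp
      then show ?thesis using assms(1) by (auto simp: tree_def)
    qed
  qed
qed

text \<open>Connectedness gives existence and acyclicity gives uniqueness, so the definite
  description in \<open>tree_path\<close> denotes a path.\<close>

lemma is_path_tree_path:
  assumes "tree T" "x \<in> verts T" "y \<in> verts T"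
  shows "is_path T x (tree_path T x y) y"
proof -
  have "graph T" "(adj T)\<^sup>*\<^sup>* x y" using assms by (auto simp: tree_def graph_def connected_def)
  then obtain p where p: "is_path T x p y" using is_path_exists assms(3) by metis
  show ?thesis
    unfolding tree_path_def using p is_path_unique[OF assms(1) _ p] by (rule theI[of "\<lambda>p. is_path T x p y"])
qed

section \<open>Existence of an embedding\<close>

text \<open>The first \<open>2 * k + 1\<close> nodes of the infinite binary heap; edge \<open>e\<close> joins \<open>e\<close> to its parent.\<close>

definition heap_tree :: "nat \<Rightarrow> (nat, nat) mgraph" where
  "heap_tree k = \<lparr>verts = {..2 * k}, edges = {1..2 * k}, ends = (\<lambda>e. {(e - 1) div 2, e})\<rparr>"

text \<open>Passing to the parent decreases the number, so every node reaches the root 0, and any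
  two nodes are joined through it.\<close>

lemma graph_heap_tree: "graph (heap_tree k)"
proof -
  have to_root: "(adj (heap_tree k))\<^sup>*\<^sup>* v 0" if "v \<le> 2 * k" for v
    using that
  proof (induction v rule: less_induct)
    case (less v)
    show ?case
    proof (cases "v = 0")
      case False
      then have "adj (heap_tree k) v ((v - 1) div 2)"
        using less.prems by (auto simp: adj_def heap_tree_def intro!: bexI[of _ v])
      moreover have "(adj (heap_tree k))\<^sup>*\<^sup>* ((v - 1) div 2) 0"
        using False less.prems by (intro less.IH) auto
      ultimately show ?thesis by (rule converse_rtranclp_into_rtranclp)
    qed simp
  qed
  have "(adj (heap_tree k))\<^sup>*\<^sup>* u v" if "u \<le> 2 * k" "v \<le> 2 * k" for u v
    using rtranclp_trans[OF to_root[OF that(1)] adj_rtranclp_sym[OF to_root[OF that(2)]]] .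
  moreover have "verts (heap_tree k) = {..2 * k}" by (simp add: heap_tree_def)
  ultimately have "connected (heap_tree k)"
    unfolding connected_def by auto
  moreover have "card {(e - 1) div 2, e} = 2" if "e \<ge> 1" for e :: nat
    using that by (subst card_2_iff) (intro exI[of _ "(e - 1) div 2"] exI[of _ e], auto)
  ultimately show ?thesis by (auto simp: graph_def heap_tree_def)
qed

text \<open>Both cycle edges at the largest vertex of a cycle would have to lead to its parent.\<close>

lemma tree_heap_tree: "tree (heap_tree k)"
proof -
  have False if c: "is_cycle (heap_tree k) vs es" for vs es
  proof -
    let ?n = "length vs"
    have n: "?n \<ge> 2" "length es = ?n" "distinct es" and es: "set es \<subseteq> {1..2 * k}"
      and en: "\<And>i. i < ?n \<Longrightarrow> {(es ! i - 1) div 2, es ! i} = {vs ! i, vs ! (Suc i mod ?n)}"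
      using c by (auto simp: is_cycle_def heap_tree_def)
    have "vs \<noteq> []" using n by auto
    then have "Max (set vs) \<in> set vs" by simp
    then obtain i where i: "i < ?n" "vs ! i = Max (set vs)" by (metis in_set_conv_nth)
    have edge_at_max: "es ! j = Max (set vs)" if "j < ?n" "i = j \<or> i = Suc j mod ?n" for j
    proof -
      have "Max (set vs) \<in> {vs ! j, vs ! (Suc j mod ?n)}"
        using that(2) unfolding i(2)[symmetric] by blast
      then have max: "Max (set vs) \<in> {(es ! j - 1) div 2, es ! j}" unfolding en[OF that(1)] .
      have "es ! j \<in> {vs ! j, vs ! (Suc j mod ?n)}" using en[OF that(1)] by blast
      moreover have "Suc j mod ?n < ?n" using that(1) by (auto intro: mod_less_divisor)
      ultimately have "es ! j \<in> set vs" using that(1) by auto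
      then have "es ! j \<le> Max (set vs)" by simp
      \<comment> \<open>An edge \<open>e \<ge> 1\<close> is larger than its parent end
        \<open>(e - 1) div 2\<close>, so the maximum cannot be that parent end.\<close>
      moreover have "es ! j \<ge> 1" using es that(1) n(2) by (metis atLeastAtMost_iff nth_mem subsetD)
      ultimately show ?thesis using max by auto
    qed
    \<comment> \<open>The cyclic predecessor of \<open>i\<close>: edges number \<open>i\<close> and
      \<open>j\<close> are the two cycle edges at the largest vertex.\<close>
    define j where "j = (if i = 0 then ?n - 1 else i - 1)"
    have j: "j < ?n" "i = Suc j mod ?n" "i \<noteq> j" using i n(1) by (auto simp: j_def)
    then have "es ! i = es ! j" using edge_at_max i(1) by metis
    then show False using j i n by (simp add: nth_eq_iff_index_eq)
  qed
  then show ?thesis using graph_heap_tree by (auto simp: tree_def)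
qed

text \<open>Only the edge to the parent, labelled \<open>v\<close>, and the edges to the two
  children can meet \<open>v\<close>.\<close>

lemma subcubic_heap_tree: "subcubic (heap_tree k)"
  unfolding subcubic_def
proof
  fix v
  have "{e \<in> edges (heap_tree k). v \<in> ends (heap_tree k) e} \<subseteq> {v, 2 * v + 1, 2 * v + 2}"
    by (auto simp: heap_tree_def)
  then have "degree (heap_tree k) v \<le> card {v, 2 * v + 1, 2 * v + 2}"
    unfolding degree_def by (intro card_mono) auto
  also have "\<dots> \<le> 3" by (simp add: card_insert_if)
  finally show "degree (heap_tree k) v \<le> 3" .
qed

text \<open>For \<open>v \<ge> k\<close> both children exceed \<open>2 * k\<close>, which leaves
  only the edge to the parent; \<open>1 \<le> k\<close> ensures that \<open>v\<close> has a
  parent.\<close>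

lemma leaf_heap_tree:
  assumes "1 \<le> k" "k \<le> v" "v \<le> 2 * k"
  shows "leaf (heap_tree k) v"
proof -
  have "{e \<in> edges (heap_tree k). v \<in> ends (heap_tree k) e} = {v}"
    using assms by (auto simp: heap_tree_def)
  then show ?thesis using assms by (simp add: leaf_def degree_def heap_tree_def)
qed

lemma embedding_exists:
  fixes G :: "('v, 'e) mgraph"
  assumes "finite (verts G)" "card (verts G) \<ge> 2"
  shows "\<exists>(T :: (nat, nat) mgraph) \<pi>. embedding G T \<pi>"
proof -
  \<comment> \<open>The leaves \<open>{k..2 * k}\<close> number \<open>k + 1\<close>, exactly one
    for each vertex of \<open>G\<close>.\<close>
  define k where "k = card (verts G) - 1"
  have k: "1 \<le> k" "card (verts G) = card {k..2 * k}" using assms by (auto simp: k_def)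
  then obtain \<pi> where "bij_betw \<pi> (verts G) {k..2 * k}"
    using finite_same_card_bij[OF assms(1)] by blast
  then have "inj_on \<pi> (verts G)" "\<forall>v\<in>verts G. k \<le> \<pi> v \<and> \<pi> v \<le> 2 * k"
    by (auto simp: bij_betw_def)
  then have "embedding G (heap_tree k) \<pi>"
    using tree_heap_tree subcubic_heap_tree leaf_heap_tree[OF k(1)]
    by (auto simp: embedding_def)
  then show ?thesis by blast
qed

section \<open>From embeddings to tree-cut decompositions\<close>

definition edges_through ::
    "('v, 'e) mgraph \<Rightarrow> ('n, 'l) mgraph \<Rightarrow> ('v \<Rightarrow> 'n) \<Rightarrow> 'n \<Rightarrow> 'e set" where
  "edges_through G T \<pi> u =
     {e \<in> edges G. \<exists>v w. ends G e = {v, w} \<and> u \<in> set (tree_path T (\<pi> v) (\<pi> w))}"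

definition embedding_bags :: "('v, 'e) mgraph \<Rightarrow> ('v \<Rightarrow> 'n) \<Rightarrow> 'n \<Rightarrow> 'v set" where
  "embedding_bags G \<pi> b = {v \<in> verts G. \<pi> v = b}"

lemma components_eqI:
  assumes "C \<in> components F" "D \<in> components F" "c \<in> C" "d \<in> D" "(adj F)\<^sup>*\<^sup>* c d"
  shows "C = D"
proof -
  obtain u u' where "C = {v \<in> verts F. (adj F)\<^sup>*\<^sup>* u v}" "D = {v \<in> verts F. (adj F)\<^sup>*\<^sup>* u' v}"
    using assms(1,2) by (auto simp: components_def)
  then show ?thesis using assms(3-5)
    by (auto dest: adj_rtranclp_sym) (meson adj_rtranclp_sym rtranclp_trans)+
qed

text \<open>This treats link and node deletion together: a tree path that avoids \<open>u\<close>
  survives in \<open>F\<close> and would put both ends of the edge into one component.\<close>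

lemma crossing_edges_subset_edges_through:
  assumes "tree T" "\<And>v. v \<in> verts G \<Longrightarrow> \<pi> v \<in> verts T"
    and avoid: "\<And>x y. adj T x y \<Longrightarrow> x \<noteq> u \<Longrightarrow> y \<noteq> u \<Longrightarrow> adj F x y"
  shows "crossing_edges G F (embedding_bags G \<pi>) \<subseteq> edges_through G T \<pi> u"
proof
  fix e assume "e \<in> crossing_edges G F (embedding_bags G \<pi>)"
  then obtain v w C D where e: "e \<in> edges G" "ends G e = {v, w}" "v \<in> verts G" "w \<in> verts G"
    and CD: "C \<in> components F" "D \<in> components F" "C \<noteq> D" "\<pi> v \<in> C" "\<pi> w \<in> D"
    by (auto simp: crossing_edges_def embedding_bags_def)
  let ?p = "tree_path T (\<pi> v) (\<pi> w)"
  have p: "is_path T (\<pi> v) ?p (\<pi> w)" using is_path_tree_path assms(1,2) e by metis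
  have "u \<in> set ?p"
  proof (rule ccontr)
    assume "u \<notin> set ?p"
    then have "successively (adj F) ?p"
      using p by (auto simp: is_path_def intro: successively_mono avoid)
    then have "(adj F)\<^sup>*\<^sup>* (\<pi> v) (\<pi> w)"
      using successively_rtranclp[of "adj F" ?p] p by (simp add: is_path_def)
    then show False using components_eqI CD by metis
  qed
  then show "e \<in> edges_through G T \<pi> u" using e by (auto simp: edges_through_def)
qed

text \<open>Either end of \<open>l\<close> can serve as \<open>u\<close>, since an adjacency between
  nodes other than \<open>u\<close> is never due to \<open>l\<close>.\<close>

lemma link_adhesion_subset_edges_through:
  assumes "tree T" "\<And>v. v \<in> verts G \<Longrightarrow> \<pi> v \<in> verts T" "u \<in> ends T l"
  shows "link_adhesion G T (embedding_bags G \<pi>) l \<subseteq> edges_through G T \<pi> u"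
  unfolding link_adhesion_def
  using assms by (intro crossing_edges_subset_edges_through) (auto simp: adj_def del_edge_def)

lemma node_adhesion_subset_edges_through:
  assumes "tree T" "\<And>v. v \<in> verts G \<Longrightarrow> \<pi> v \<in> verts T"
  shows "node_adhesion G T (embedding_bags G \<pi>) b \<subseteq> edges_through G T \<pi> b"
proof -
  have "crossing_edges G (del_vert T b) (embedding_bags G \<pi>) \<subseteq> edges_through G T \<pi> b"
    using assms by (intro crossing_edges_subset_edges_through) (auto simp: adj_def del_vert_def)
  then show ?thesis by (auto simp: node_adhesion_def)
qed

lemma embedding_verts: "embedding G T \<pi> \<Longrightarrow> v \<in> verts G \<Longrightarrow> \<pi> v \<in> verts T"
  by (auto simp: embedding_def leaf_def)

lemma tree_cut_decomposition_embedding_bags: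
  "embedding G T \<pi> \<Longrightarrow> tree_cut_decomposition G T (embedding_bags G \<pi>)"
  using embedding_verts[of G T \<pi>]
  by (auto simp: tree_cut_decomposition_def embedding_def embedding_bags_def)

lemma card_edges_through_le_vertex_congestion:
  assumes "finite (verts T)" "u \<in> verts T"
  shows "card (edges_through G T \<pi> u) \<le> vertex_congestion G T \<pi>"
  unfolding vertex_congestion_def edges_through_def using assms by (intro Max_ge) auto

text \<open>This pays for the single vertex in the bag of a leaf. An edge of \<open>G\<close> counts
  at the node where one of its ends is embedded.\<close>

lemma vertex_congestion_pos:
  assumes "graph G" "card (verts G) \<ge> 2" "embedding G T \<pi>"
  shows "vertex_congestion G T \<pi> \<ge> 1"
proof -
  obtain x y where xy: "x \<in> verts G" "y \<in> verts G" "x \<noteq> y"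
    using assms(2) card_le_Suc0_iff_eq[of "verts G"] assms(1)
    by (metis One_nat_def Suc_1 Suc_n_not_le_n graph_def le_trans)
  then have "(adj G)\<^sup>*\<^sup>* x y" using assms(1) by (auto simp: graph_def connected_def)
  \<comment> \<open>The first step of a walk from \<open>x\<close> to \<open>y\<close> supplies an
    edge.\<close>
  then obtain z where z: "adj G x z" using xy(3) by (auto elim: converse_rtranclpE)
  then obtain e where e: "e \<in> edges G" "ends G e = {x, z}" by (auto simp: adj_def)
  have "\<pi> x \<in> verts T" "\<pi> z \<in> verts T"
    using embedding_verts[OF assms(3)] graph_adj_verts[OF assms(1) z] by auto
  moreover have T: "tree T" using assms(3) by (simp add: embedding_def)
  ultimately have "is_path T (\<pi> x) (tree_path T (\<pi> x) (\<pi> z)) (\<pi> z)"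
    by (simp add: is_path_tree_path)
  then have "\<pi> x \<in> set (tree_path T (\<pi> x) (\<pi> z))"
    by (metis hd_in_set is_path_def)
  then have "e \<in> edges_through G T \<pi> (\<pi> x)" using e by (auto simp: edges_through_def)
  moreover have "finite (edges_through G T \<pi> (\<pi> x))"
    using assms(1) by (simp add: edges_through_def graph_def)
  ultimately have "1 \<le> card (edges_through G T \<pi> (\<pi> x))"
    by (metis One_nat_def Suc_leI card_gt_0_iff empty_iff)
  also have "\<dots> \<le> vertex_congestion G T \<pi>"
    using T \<open>\<pi> x \<in> verts T\<close>
    by (intro card_edges_through_le_vertex_congestion) (auto simp: tree_def graph_def)
  finally show ?thesis .
qed

lemma width_embedding_bags_le:
  assumes "graph G" "card (verts G) \<ge> 2" "embedding G T \<pi>"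
  shows "width G T (embedding_bags G \<pi>) \<le> vertex_congestion G T \<pi>"
proof -
  let ?X = "embedding_bags G \<pi>" and ?k = "vertex_congestion G T \<pi>"
  have T: "tree T" "graph T" and inj: "inj_on \<pi> (verts G)"
    using assms(3) by (auto simp: embedding_def tree_def)
  have fin: "finite (verts T)" "finite (edges T)" "verts T \<noteq> {}"
    using T(2) by (auto simp: graph_def connected_def)
  have through: "card A \<le> ?k" if "A \<subseteq> edges_through G T \<pi> u" "u \<in> verts T" for A u
  proof -
    have "card A \<le> card (edges_through G T \<pi> u)"
      using that(1) assms(1) by (intro card_mono) (auto simp: edges_through_def graph_def)
    also have "\<dots> \<le> ?k" using card_edges_through_le_vertex_congestion[OF fin(1) that(2)] .
    finally show ?thesis .
  qed
  have link: "card (link_adhesion G T ?X l) \<le> ?k" if "l \<in> edges T" for l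
  proof -
    have "card (ends T l) = 2" "ends T l \<subseteq> verts T" using T(2) that by (auto simp: graph_def)
    then obtain u where u: "u \<in> ends T l" "u \<in> verts T" by (auto simp: card_2_iff)
    show ?thesis
      by (rule through[OF link_adhesion_subset_edges_through[OF T(1) _ u(1)] u(2)])
        (rule embedding_verts[OF assms(3)])
  qed
  have node: "card (?X b) + card (node_adhesion G T ?X b) \<le> ?k" if "b \<in> verts T" for b
  proof (cases "leaf T b")
    case True
    have "card (?X b) \<le> 1"
      using inj assms(1) card_le_Suc0_iff_eq[of "?X b"]
      by (auto simp: embedding_bags_def graph_def inj_on_def)
    then show ?thesis using True vertex_congestion_pos[OF assms] by (simp add: node_adhesion_def)
  next
    case False
    then have "?X b = {}" using assms(3) by (auto simp: embedding_bags_def embedding_def)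
    then show ?thesis
      using through[OF node_adhesion_subset_edges_through[OF T(1) embedding_verts[OF assms(3)]] that]
      by simp
  qed
  \<comment> \<open>The set under \<open>Max\<close> is nonempty even if \<open>T\<close> has no
    links, because \<open>T\<close> has a node.\<close>
  show ?thesis unfolding width_def using fin link node by (subst Max_le_iff) auto
qed

theorem theorem7p3:
  fixes G :: "('v, 'e) mgraph"
  assumes "graph G"
    and "card (verts G) \<ge> 3"
  shows "scw G \<le> vcon G"
proof -
  have "\<exists>k. \<exists>(T :: (nat, nat) mgraph) \<pi>. embedding G T \<pi> \<and> vertex_congestion G T \<pi> = k"
    using embedding_exists[of G] assms by (auto simp: graph_def)
  \<comment> \<open>An optimal embedding is fixed. As \<open>scw\<close> and \<open>vcon\<close>
    range over the same type of trees, its \<open>T\<close> also competes in the minimum for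
    \<open>scw\<close>.\<close>
  from LeastI_ex[OF this] obtain T :: "(nat, nat) mgraph" and \<pi>
    where emb: "embedding G T \<pi>" and vcon: "vertex_congestion G T \<pi> = vcon G"
    unfolding vcon_def by blast
  have "scw G \<le> width G T (embedding_bags G \<pi>)"
    unfolding scw_def using tree_cut_decomposition_embedding_bags[OF emb]
    by (intro Least_le) blast
  also have "\<dots> \<le> vcon G" using width_embedding_bags_le[OF assms(1) _ emb] assms(2) vcon by simp
  finally show ?thesis .
qed

end
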